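(* Let $\zeta$ and $\hat\zeta$ be charge curves. Consider an instance of the Electric Bus Scheduling Problem with finite non-empty trip set $\mathcal{T}$ such that assigning a unique bus to each trip yields an energy-feasible solution, i.e., for every trip $\tau\in\mathcal{T}$ there is a depot $d$ such that the course $(d,\tau^s,\tau^e,d)$ is operationally admissible and $e(d,\tau^s)+e(\tau^s,\tau^e)+e(\tau^e,d)\le 1$. Then the minimum number of courses of a strongly energy-feasible vehicle schedule (under $\zeta$ and $\hat\zeta$) is at most $|\mathcal{T}|$ times the minimum number of courses of an energy-feasible vehicle schedule (under $\zeta$). Moreover, the bound is tight: there are charge curves $\zeta,\hat\zeta$ and instances in which for every trip $\tau\in\mathcal{T}$ there is a depot $d$ such that the course $(d,\tau^s,\tau^e,d)$ is operationally admissible and $e(d,\tau^s)+e(\tau^s,\tau^e)+e(\tau^e,d)\le 1$, with arbitrarily large $|\mathcal{T}|$, for which the minimum number of courses of a strongly energy-feasible vehicle schedule (under $\zeta$ and $\hat\zeta$) equals $|\mathcal{T}|$ times the minimum number of courses of an energy-feasible vehicle schedule (under $\zeta$).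
   Context: **Charge curves.** A charge curve is a function $\zeta:[0,\infty)\to[0,1]$ with $\zeta(0)=0$ for which there is $t_{full}>0$ such that $\zeta$ is strictly increasing on $[0,t_{full}]$, $\zeta(t)=1$ for all $t\ge t_{full}$, and $\zeta$ is absolutely continuous with (almost everywhere existing) derivative $\zeta'$ monotonically non-increasing; in particular $\zeta$ is concave. It maps time spent charging an initially empty battery to the resulting state of charge. Let $\zeta^{-1}:[0,1]\to[0,t_{full}]$ be the inverse of $\zeta|_{[0,t_{full}]}$. The charge increment function is $\Delta\zeta:[0,1]\times[0,\infty)\to[0,1]$, $\Delta\zeta(y,t)=\zeta(\zeta^{-1}(y)+t)-y$. **Instances.** An instance (with one vehicle type) consists of a finite set $\mathcal{T}$ of timetabled trips, each trip $\tau$ having a start $\tau^s$ and an end $\tau^e$ with fixed times; a finite set of depots; a finite set of charging slots, each usable by at most one bus at a time and possibly only during prescribed availability time intervals; information (travel times / admissible connections) on which activities can be performed consecutively by a bus; and a non-negative function $e(\cdot,\cdot)$, the relative energy consumption (as a fraction of the battery capacity) between two locations, with $e(\tau^s,\tau^e)$ the consumption of trip $\tau$. The function $e$ need not be symmetric but satisfies the triangle inequality $e(a,b)\le e(a,c)+e(c,b)$. **Courses and schedules.** A block is a sequence of trips serviced in order without interruption, written as the sequence of starts and ends of its trips. A (vehicle) course is an alternating sequence of $m$ blocks $B_1,\dots,B_m$ and $m-1$ recharge events, starting and ending at the same depot, all operationally admissible (times, connections, slot availability). It is written as the tuple $C=(d^s)\times B_1\times(s_1^s,s_1^e)\times B_2\times\dots\times(s_{m-1}^s,s_{m-1}^e)\times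 B_m\times(d^e)$, where $d^s$ is the initial departure from the depot, $d^e$ the final arrival, and $s_i^s,s_i^e$ are arrival at and departure from the $i$-th recharge event, which has an associated charging duration $t_i\ge 0$. A vehicle schedule is a set of courses that together service every trip of $\mathcal{T}$ exactly once and respect the charging slot capacities. **Energy-feasibility.** Charge states are propagated along $C=(C_1,C_2,\dots)$ by $y(d^s)=1$, $y(s_i^e)=y(s_i^s)+\Delta\zeta(y(s_i^s),t_i)$, and $y(C_j)=y(C_{j-1})-e(C_{j-1},C_j)$ for all other elements. Let $\hat y$ be the map obtained by replacing $\zeta$ by $\hat\zeta$. Let $E(C_j)\ge 0$ be the minimum state of charge required to reach the nearest depot or charge station from location $C_j$. A course is energy-feasible (under $\zeta$) if $y(C_j)\ge E(C_j)$ for all $j$; weakly energy-feasible if $\hat y(C_j)\ge E(C_j)$ for all $j$; strongly energy-feasible if it is both energy-feasible and weakly energy-feasible. A vehicle schedule has one of these properties if all of its courses do. *)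

theory Defs
  imports "HOL-Analysis.Analysis" "HOL-Library.Extended_Nat"
begin

section \<open>Charge curves\<close>

text \<open>Only the values on \<open>{0..}\<close> of a curve \<open>\<zeta> :: real \<Rightarrow> real\<close> are relevant. The notion
  \<open>absolutely_continuous\<close> of HOL-Analysis concerns measures, so absolute continuity of functions
  is introduced here: the pairs \<open>(a k, b k)\<close> are the end points of finitely many
  non-overlapping subintervals.\<close>

definition abs_continuous_on :: "real set \<Rightarrow> (real \<Rightarrow> real) \<Rightarrow> bool" where
  "abs_continuous_on S f \<longleftrightarrow>
    (\<forall>\<epsilon>>0. \<exists>\<delta>>0. \<forall>(n::nat) a b.
      (\<forall>k<n. a k \<le> b k \<and> {a k..b k} \<subseteq> S) \<longrightarrow>
      disjoint_family_on (\<lambda>k. {a k<..<b k}) {..<n} \<longrightarrow>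
      (\<Sum>k<n. b k - a k) < \<delta> \<longrightarrow>
      (\<Sum>k<n. \<bar>f (b k) - f (a k)\<bar>) < \<epsilon>)"

definition full_at :: "(real \<Rightarrow> real) \<Rightarrow> real \<Rightarrow> bool" where
  "full_at \<zeta> T \<longleftrightarrow> T > 0 \<and> strict_mono_on {0..T} \<zeta> \<and> (\<forall>t\<ge>T. \<zeta> t = 1)"

definition charge_curve :: "(real \<Rightarrow> real) \<Rightarrow> bool" where
  "charge_curve \<zeta> \<longleftrightarrow>
    \<zeta> \<in> {0..} \<rightarrow> {0..1} \<and> \<zeta> 0 = 0 \<and> (\<exists>T. full_at \<zeta> T) \<and>
    abs_continuous_on {0..} \<zeta> \<and>
    negligible {t. t > 0 \<and> \<not> \<zeta> differentiable (at t)} \<and>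
    antimono_on {t. t > 0 \<and> \<zeta> differentiable (at t)} (deriv \<zeta>)"

text \<open>The time \<open>t_full\<close> is unique: \<open>full_at \<zeta> T\<close> and \<open>full_at \<zeta> T'\<close> with \<open>T < T'\<close> would give
  \<open>1 = \<zeta> T < \<zeta> T' = 1\<close>.\<close>

definition full_time :: "(real \<Rightarrow> real) \<Rightarrow> real" where
  "full_time \<zeta> = (THE T. full_at \<zeta> T)"

definition charge_time :: "(real \<Rightarrow> real) \<Rightarrow> real \<Rightarrow> real" where
  "charge_time \<zeta> = the_inv_into {0..full_time \<zeta>} \<zeta>"

definition charge_increment :: "(real \<Rightarrow> real) \<Rightarrow> real \<Rightarrow> real \<Rightarrow> real" where
  "charge_increment \<zeta> y t = \<zeta> (charge_time \<zeta> y + t) - y"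


section \<open>Instances\<close>

text \<open>The locations between which consumption and travel times are given are the starts and
  ends of the trips, the depots, and the places of the charging slots. Since the start and the
  end of a trip are locations of their own, \<open>energy I (Trip_Start \<tau>) (Trip_End \<tau>)\<close> is the
  consumption of the trip itself, even if it is a round trip.\<close>

datatype ('t, 'd, 's) location = Trip_Start 't | Trip_End 't | Depot 'd | Slot 's

text \<open>A recharge at a slot must lie within one of the intervals in \<open>availability\<close>; a slot
  without restrictions has \<open>UNIV\<close> among them.\<close>

record ('t, 'd, 's) ebsp =
  trips :: "'t set"
  start_time :: "'t \<Rightarrow> real"
  end_time :: "'t \<Rightarrow> real"
  depots :: "'d set"
  slots :: "'s set"
  availability :: "'s \<Rightarrow> real set set"
  connections :: "(('t, 'd, 's) location \<times> ('t, 'd, 's) location) set"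
  travel_time :: "('t, 'd, 's) location \<Rightarrow> ('t, 'd, 's) location \<Rightarrow> real"
  energy :: "('t, 'd, 's) location \<Rightarrow> ('t, 'd, 's) location \<Rightarrow> real"

definition facilities :: "('t, 'd, 's) ebsp \<Rightarrow> ('t, 'd, 's) location set" where
  "facilities I = Depot ` depots I \<union> Slot ` slots I"

definition locations :: "('t, 'd, 's) ebsp \<Rightarrow> ('t, 'd, 's) location set" where
  "locations I = Trip_Start ` trips I \<union> Trip_End ` trips I \<union> facilities I"

definition ebsp_instance :: "('t, 'd, 's) ebsp \<Rightarrow> bool" where
  "ebsp_instance I \<longleftrightarrow>
    finite (trips I) \<and> finite (depots I) \<and> finite (slots I) \<and>
    (\<forall>\<tau>\<in>trips I. start_time I \<tau> \<le> end_time I \<tau>) \<and>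
    (\<forall>s\<in>slots I. finite (availability I s) \<and> (\<forall>J\<in>availability I s. is_interval J)) \<and>
    (\<forall>a\<in>locations I. \<forall>b\<in>locations I. travel_time I a b \<ge> 0) \<and>
    (\<forall>a\<in>locations I. \<forall>b\<in>locations I. energy I a b \<ge> 0) \<and>
    (\<forall>a\<in>locations I. \<forall>b\<in>locations I. \<forall>c\<in>locations I.
      energy I a b \<le> energy I a c + energy I c b)"


section \<open>Courses and schedules\<close>

record 's recharge =
  slot :: 's
  arrival :: real
  duration :: real

abbreviation departure :: "'s recharge \<Rightarrow> real" where
  "departure r \<equiv> arrival r + duration r"

record ('t, 'd, 's) course =
  depot :: 'd
  blocks :: "'t list list"
  recharges :: "'s recharge list"

datatype ('t, 's) activity = Service 't | Charge "'s recharge"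

fun alternate :: "'t list list \<Rightarrow> 's recharge list \<Rightarrow> ('t, 's) activity list" where
  "alternate (B # Bs) (r # rs) = map Service B @ Charge r # alternate Bs rs"
| "alternate (B # Bs) [] = map Service B"
| "alternate [] rs = []"

definition activities :: "('t, 'd, 's) course \<Rightarrow> ('t, 's) activity list" where
  "activities C = alternate (blocks C) (recharges C)"

fun begin_of :: "('t, 'd, 's) ebsp \<Rightarrow> ('t, 's) activity \<Rightarrow> ('t, 'd, 's) location \<times> real" where
  "begin_of I (Service \<tau>) = (Trip_Start \<tau>, start_time I \<tau>)"
| "begin_of I (Charge r) = (Slot (slot r), arrival r)"

fun end_of :: "('t, 'd, 's) ebsp \<Rightarrow> ('t, 's) activity \<Rightarrow> ('t, 'd, 's) location \<times> real" where
  "end_of I (Service \<tau>) = (Trip_End \<tau>, end_time I \<tau>)"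
| "end_of I (Charge r) = (Slot (slot r), departure r)"

text \<open>A bus may wait between two activities.\<close>

definition can_follow :: "('t, 'd, 's) ebsp \<Rightarrow> ('t, 's) activity \<Rightarrow> ('t, 's) activity \<Rightarrow> bool" where
  "can_follow I x y \<longleftrightarrow>
    (let (a, t) = end_of I x; (b, u) = begin_of I y
     in (a, b) \<in> connections I \<and> t + travel_time I a b \<le> u)"

text \<open>The departure time from the depot and the arrival time at the depot are not prescribed, so
  that the pull-out and pull-in trips only have to be admissible connections.\<close>

definition admissible_course :: "('t, 'd, 's) ebsp \<Rightarrow> ('t, 'd, 's) course \<Rightarrow> bool" where
  "admissible_course I C \<longleftrightarrow>
    depot C \<in> depots I \<and>
    length (blocks C) = length (recharges C) + 1 \<and>
    (\<forall>B\<in>set (blocks C). B \<noteq> [] \<and> set B \<subseteq> trips I) \<and>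
    (\<forall>r\<in>set (recharges C). slot r \<in> slots I \<and> duration r \<ge> 0 \<and>
      (\<exists>J\<in>availability I (slot r). {arrival r..departure r} \<subseteq> J)) \<and>
    successively (can_follow I) (activities C) \<and>
    (Depot (depot C), fst (begin_of I (hd (activities C)))) \<in> connections I \<and>
    (fst (end_of I (last (activities C))), Depot (depot C)) \<in> connections I"

definition single_trip_course :: "'d \<Rightarrow> 't \<Rightarrow> ('t, 'd, 's) course" where
  "single_trip_course d \<tau> = \<lparr>depot = d, blocks = [[\<tau>]], recharges = []\<rparr>"

definition vehicle_schedule :: "('t, 'd, 's) ebsp \<Rightarrow> ('t, 'd, 's) course set \<Rightarrow> bool" where
  "vehicle_schedule I S \<longleftrightarrow>
    finite S \<and> (\<forall>C\<in>S. admissible_course I C) \<and>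
    (\<forall>\<tau>\<in>trips I. (\<Sum>C\<in>S. count_list (concat (blocks C)) \<tau>) = 1) \<and>
    (\<forall>C\<in>S. \<forall>C'\<in>S. C \<noteq> C' \<longrightarrow>
      (\<forall>r\<in>set (recharges C). \<forall>r'\<in>set (recharges C'). slot r = slot r' \<longrightarrow>
        departure r \<le> arrival r' \<or> departure r' \<le> arrival r))"


section \<open>Energy-feasibility\<close>

text \<open>The elements of a course written as a tuple
  \<open>(d\<^sup>s) \<times> B\<^sub>1 \<times> (s\<^sub>1\<^sup>s, s\<^sub>1\<^sup>e) \<times> \<dots> \<times> B\<^sub>m \<times> (d\<^sup>e)\<close>. The pair \<open>(a, None)\<close> is a location reached by
  driving (or the initial depot), and \<open>(a, Some t)\<close> is the end \<open>s\<^sub>i\<^sup>e\<close> of a recharge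
  event with charging duration \<open>t\<close>.\<close>

fun elements :: "('t, 's) activity \<Rightarrow> (('t, 'd, 's) location \<times> real option) list" where
  "elements (Service \<tau>) = [(Trip_Start \<tau>, None), (Trip_End \<tau>, None)]"
| "elements (Charge r) = [(Slot (slot r), None), (Slot (slot r), Some (duration r))]"

definition course_tuple ::
    "('t, 'd, 's) course \<Rightarrow> (('t, 'd, 's) location \<times> real option) list" where
  "course_tuple C =
    (Depot (depot C), None) # concat (map elements (activities C)) @ [(Depot (depot C), None)]"

fun charge_state ::
    "('t, 'd, 's) ebsp \<Rightarrow> (real \<Rightarrow> real) \<Rightarrow> ('t, 'd, 's) course \<Rightarrow> nat \<Rightarrow> real" where
  "charge_state I \<zeta> C 0 = 1"
| "charge_state I \<zeta> C (Suc j) =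
    (let y = charge_state I \<zeta> C j
     in case course_tuple C ! Suc j of
          (b, Some t) \<Rightarrow> y + charge_increment \<zeta> y t
        | (b, None) \<Rightarrow> y - energy I (fst (course_tuple C ! j)) b)"

text \<open>At a depot or a charging slot nothing is required to reach one, whatever
  \<open>energy I a a\<close> is.\<close>

definition required_charge :: "('t, 'd, 's) ebsp \<Rightarrow> ('t, 'd, 's) location \<Rightarrow> real" where
  "required_charge I a =
    (if a \<in> facilities I then 0 else Min (energy I a ` facilities I))"

definition energy_feasible ::
    "('t, 'd, 's) ebsp \<Rightarrow> (real \<Rightarrow> real) \<Rightarrow> ('t, 'd, 's) course \<Rightarrow> bool" where
  "energy_feasible I \<zeta> C \<longleftrightarrow>
    (\<forall>j<length (course_tuple C).
      charge_state I \<zeta> C j \<ge> required_charge I (fst (course_tuple C ! j)))"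

text \<open>Weak energy-feasibility is \<open>energy_feasible I \<zeta>'\<close>, where \<open>\<zeta>'\<close> is the second charge curve.\<close>

definition strongly_energy_feasible ::
    "('t, 'd, 's) ebsp \<Rightarrow> (real \<Rightarrow> real) \<Rightarrow> (real \<Rightarrow> real) \<Rightarrow> ('t, 'd, 's) course \<Rightarrow> bool" where
  "strongly_energy_feasible I \<zeta> \<zeta>' C \<longleftrightarrow> energy_feasible I \<zeta> C \<and> energy_feasible I \<zeta>' C"

text \<open>The minimum number of courses of a vehicle schedule all of whose courses satisfy \<open>P\<close>; it is
  \<open>\<infinity>\<close> if there is no such schedule.\<close>

definition min_courses ::
    "('t, 'd, 's) ebsp \<Rightarrow> (('t, 'd, 's) course \<Rightarrow> bool) \<Rightarrow> enat" where
  "min_courses I P = (INF S \<in> {S. vehicle_schedule I S \<and> (\<forall>C\<in>S. P C)}. enat (card S))"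

definition individually_serviceable :: "('t, 'd, 's) ebsp \<Rightarrow> bool" where
  "individually_serviceable I \<longleftrightarrow>
    (\<forall>\<tau>\<in>trips I. \<exists>d\<in>depots I.
      admissible_course I (single_trip_course d \<tau>) \<and>
      energy I (Depot d) (Trip_Start \<tau>) + energy I (Trip_Start \<tau>) (Trip_End \<tau>)
        + energy I (Trip_End \<tau>) (Depot d) \<le> 1)"

end

theory Submission
  imports Defs
begin

text \<open>A schedule of single-trip courses never recharges, so its energy-feasibility does not depend
  on the charge curve. It uses \<open>card (trips I)\<close> courses, whereas every schedule of a non-empty trip
  set uses at least one; this is the upper bound.

  For tightness, let every trip consume a full battery and all other driving nothing, and offer
  charging only during intervals of length one, one such interval between each two consecutive
  trips. If \<open>\<zeta>\<close> fills the battery linearly in time one, a single bus can service all trips,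
  recharging completely after each of them. If \<open>\<zeta>'\<close> fills the battery linearly in time two, a
  single recharge gives at most half a charge (\<open>relay_course_at_most_one_trip\<close>). Two blocks are
  separated by just one recharge event, and there is none within a block, so that no bus can service a second trip, and every
  weakly energy-feasible schedule has as many courses as there are trips. The curves do not depend
  on the number of trips.\<close>


section \<open>Energy-feasibility by recursion along a course\<close>

text \<open>\<open>charge_state\<close> indexes into the whole course tuple. For concrete courses it is more
  convenient to carry the current charge \<open>y\<close> and location \<open>a\<close> through the remaining elements.\<close>

fun sustains :: "('t, 'd, 's) ebsp \<Rightarrow> (real \<Rightarrow> real) \<Rightarrow> real \<Rightarrow> ('t, 'd, 's) location
    \<Rightarrow> (('t, 'd, 's) location \<times> real option) list \<Rightarrow> bool" where
  "sustains I \<zeta> y a [] \<longleftrightarrow> True"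
| "sustains I \<zeta> y a ((b, None) # es) \<longleftrightarrow>
    required_charge I b \<le> y - energy I a b \<and> sustains I \<zeta> (y - energy I a b) b es"
| "sustains I \<zeta> y a ((b, Some t) # es) \<longleftrightarrow>
    required_charge I b \<le> y + charge_increment \<zeta> y t \<and>
    sustains I \<zeta> (y + charge_increment \<zeta> y t) b es"

lemma sustains_drop_iff:
  assumes "k < length (course_tuple C)"
  shows "sustains I \<zeta> (charge_state I \<zeta> C k) (fst (course_tuple C ! k))
      (drop (Suc k) (course_tuple C)) \<longleftrightarrow>
    (\<forall>j. k < j \<and> j < length (course_tuple C) \<longrightarrow>
      required_charge I (fst (course_tuple C ! j)) \<le> charge_state I \<zeta> C j)"
  using assms
proof (induction "length (course_tuple C) - k" arbitrary: k)
  case 0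
  then show ?case by simp
next
  case (Suc m)
  let ?T = "course_tuple C"
  show ?case
  proof (cases "Suc k < length ?T")
    case False
    then show ?thesis by auto
  next
    case True
    have IH: "sustains I \<zeta> (charge_state I \<zeta> C (Suc k)) (fst (?T ! Suc k)) (drop (Suc (Suc k)) ?T)
        \<longleftrightarrow> (\<forall>j. Suc k < j \<and> j < length ?T \<longrightarrow>
              required_charge I (fst (?T ! j)) \<le> charge_state I \<zeta> C j)"
      using Suc.hyps True by (intro Suc.hyps(1)) auto
    have split: "(\<forall>j. k < j \<and> j < length ?T \<longrightarrow> P j) \<longleftrightarrow>
        P (Suc k) \<and> (\<forall>j. Suc k < j \<and> j < length ?T \<longrightarrow> P j)" for P
      using True by (metis Suc_lessI lessI less_trans)
    obtain b c where bc: "?T ! Suc k = (b, c)" by fastforce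
    have "drop (Suc k) ?T = (b, c) # drop (Suc (Suc k)) ?T"
      using Cons_nth_drop_Suc[OF True] bc by simp
    then show ?thesis
      unfolding split using IH bc by (cases c) (simp_all add: Let_def)
  qed
qed

lemma energy_feasible_iff_sustains:
  "energy_feasible I \<zeta> C \<longleftrightarrow>
    required_charge I (Depot (depot C)) \<le> 1 \<and>
    sustains I \<zeta> 1 (Depot (depot C))
      (concat (map elements (activities C)) @ [(Depot (depot C), None)])"
proof -
  let ?T = "course_tuple C"
  have T: "?T ! 0 = (Depot (depot C), None)"
    "drop (Suc 0) ?T = concat (map elements (activities C)) @ [(Depot (depot C), None)]"
    "0 < length ?T"
    by (simp_all add: course_tuple_def)
  have "energy_feasible I \<zeta> C \<longleftrightarrow>
      required_charge I (fst (?T ! 0)) \<le> charge_state I \<zeta> C 0 \<and>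
      (\<forall>j. 0 < j \<and> j < length ?T \<longrightarrow>
        required_charge I (fst (?T ! j)) \<le> charge_state I \<zeta> C j)"
    unfolding energy_feasible_def using T(3) by (metis not_gr_zero)
  then show ?thesis
    using sustains_drop_iff[OF T(3), of I \<zeta>] T by simp
qed


section \<open>The upper bound\<close>

lemma required_charge_facility [simp]:
  "a \<in> facilities I \<Longrightarrow> required_charge I a = 0"
  by (simp add: required_charge_def)

lemma required_charge_le:
  assumes "ebsp_instance I" "b \<in> facilities I" "energy I a b \<ge> 0"
  shows "required_charge I a \<le> energy I a b"
proof -
  have "finite (facilities I)"
    using assms(1) by (simp add: ebsp_instance_def facilities_def)
  then show ?thesis
    using assms by (auto simp: required_charge_def intro: Min_le)
qed

text \<open>The battery need not be refilled, so the charge curve is arbitrary. By the triangle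
  inequality, the energy for the rest of the course suffices to return to the depot from anywhere
  on it.\<close>

lemma single_trip_course_energy_feasible:
  assumes I: "ebsp_instance I" and \<tau>: "\<tau> \<in> trips I" and d: "d \<in> depots I"
    and le: "energy I (Depot d) (Trip_Start \<tau>) + energy I (Trip_Start \<tau>) (Trip_End \<tau>)
        + energy I (Trip_End \<tau>) (Depot d) \<le> 1"
  shows "energy_feasible I \<zeta> (single_trip_course d \<tau>)"
proof -
  have loc: "Depot d \<in> locations I" "Trip_Start \<tau> \<in> locations I" "Trip_End \<tau> \<in> locations I"
    and fac: "Depot d \<in> facilities I"
    using \<tau> d by (auto simp: locations_def facilities_def)
  have nonneg: "energy I a b \<ge> 0" if "a \<in> locations I" "b \<in> locations I" for a b
    using I that by (simp add: ebsp_instance_def)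
  have "energy I (Trip_Start \<tau>) (Depot d)
      \<le> energy I (Trip_Start \<tau>) (Trip_End \<tau>) + energy I (Trip_End \<tau>) (Depot d)"
    using I loc unfolding ebsp_instance_def by blast
  moreover have "required_charge I (Trip_Start \<tau>) \<le> energy I (Trip_Start \<tau>) (Depot d)"
    "required_charge I (Trip_End \<tau>) \<le> energy I (Trip_End \<tau>) (Depot d)"
    using required_charge_le[OF I fac] nonneg loc by auto
  ultimately show ?thesis
    using le fac
    by (simp add: energy_feasible_iff_sustains single_trip_course_def activities_def)
qed

lemma min_courses_le_card_trips:
  assumes I: "ebsp_instance I" and ser: "individually_serviceable I"
  shows "min_courses I (strongly_energy_feasible I \<zeta> \<zeta>') \<le> enat (card (trips I))"
proof -
  obtain d where d: "\<And>\<tau>. \<tau> \<in> trips I \<Longrightarrow> d \<tau> \<in> depots I \<and>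
      admissible_course I (single_trip_course (d \<tau>) \<tau>) \<and>
      energy I (Depot (d \<tau>)) (Trip_Start \<tau>) + energy I (Trip_Start \<tau>) (Trip_End \<tau>)
        + energy I (Trip_End \<tau>) (Depot (d \<tau>)) \<le> 1"
    using ser unfolding individually_serviceable_def by metis
  define f where "f = (\<lambda>\<tau>. single_trip_course (d \<tau>) \<tau> :: ('a, 'b, 'c) course)"
  have fin: "finite (trips I)"
    using I by (simp add: ebsp_instance_def)
  have inj: "inj_on f (trips I)"
    by (auto simp: inj_on_def f_def single_trip_course_def)
  have "(\<Sum>C\<in>f ` trips I. count_list (concat (blocks C)) \<tau>) = 1" if "\<tau> \<in> trips I" for \<tau>
  proof -
    have "(\<Sum>C\<in>f ` trips I. count_list (concat (blocks C)) \<tau>)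
        = (\<Sum>\<sigma>\<in>trips I. if \<sigma> = \<tau> then 1 else 0)"
      unfolding sum.reindex[OF inj] by (rule sum.cong) (auto simp: f_def single_trip_course_def)
    then show ?thesis
      using that fin by simp
  qed
  then have "vehicle_schedule I (f ` trips I)"
    using fin d by (auto simp: vehicle_schedule_def f_def single_trip_course_def)
  moreover have "\<forall>C\<in>f ` trips I. strongly_energy_feasible I \<zeta> \<zeta>' C"
    using single_trip_course_energy_feasible[OF I] d
    by (auto simp: strongly_energy_feasible_def f_def)
  ultimately have "min_courses I (strongly_energy_feasible I \<zeta> \<zeta>') \<le> enat (card (f ` trips I))"
    unfolding min_courses_def by (intro INF_lower) auto
  then show ?thesis
    by (simp add: card_image[OF inj])
qed

lemma min_courses_ge_1:
  assumes "trips I \<noteq> {}"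
  shows "1 \<le> min_courses I P"
  unfolding min_courses_def
proof (rule INF_greatest)
  fix S assume "S \<in> {S. vehicle_schedule I S \<and> (\<forall>C\<in>S. P C)}"
  then have "finite S" "S \<noteq> {}"
    using assms by (auto simp: vehicle_schedule_def)
  then show "1 \<le> enat (card S)"
    by (simp add: one_enat_def Suc_le_eq card_gt_0_iff)
qed

lemma strong_min_courses_le:
  assumes "ebsp_instance I" "trips I \<noteq> {}" "individually_serviceable I"
  shows "min_courses I (strongly_energy_feasible I \<zeta> \<zeta>')
    \<le> enat (card (trips I)) * min_courses I P"
proof -
  have "enat (card (trips I)) * 1 \<le> enat (card (trips I)) * min_courses I P"
    by (intro mult_left_mono min_courses_ge_1 assms) simp
  then show ?thesis
    using min_courses_le_card_trips[OF assms(1,3)] by (metis mult.right_neutral order_trans)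
qed


section \<open>Charging an empty battery, and linear charge curves\<close>

lemma full_at_unique:
  assumes "full_at \<zeta> T" "full_at \<zeta> T'"
  shows "T' = T"
proof -
  have False if "full_at \<zeta> A" "full_at \<zeta> B" "A < B" for A B
    using that strict_mono_onD[of "{0..B}" \<zeta> A B] by (auto simp: full_at_def)
  then show ?thesis
    using assms by (metis linorder_neqE_linordered_idom)
qed

lemma charge_increment_empty:
  assumes "charge_curve \<zeta>"
  shows "charge_increment \<zeta> 0 t = \<zeta> t"
proof -
  obtain T where T: "full_at \<zeta> T"
    using assms by (auto simp: charge_curve_def)
  then have "full_time \<zeta> = T"
    unfolding full_time_def using full_at_unique by blast
  moreover have "inj_on \<zeta> {0..T}" "0 \<in> {0..T}"
    using T by (auto simp: full_at_def intro: strict_mono_on_imp_inj_on)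
  ultimately have "charge_time \<zeta> 0 = 0"
    using assms the_inv_into_f_f[of \<zeta> "{0..T}" 0] by (simp add: charge_time_def charge_curve_def)
  then show ?thesis
    by (simp add: charge_increment_def)
qed

definition linear_curve :: "real \<Rightarrow> real \<Rightarrow> real" where
  "linear_curve T t = min (t / T) 1"

lemma linear_curve_has_derivative:
  assumes "T > 0" "t \<noteq> T"
  shows "(linear_curve T has_real_derivative (if t < T then 1 / T else 0)) (at t)"
proof (cases "t < T")
  case True
  have "((\<lambda>s. s / T) has_real_derivative 1 / T) (at t)"
    using assms by (auto intro!: derivative_eq_intros)
  moreover have "eventually (\<lambda>s. s / T = linear_curve T s) (nhds t)"
    using eventually_nhds_in_open[of "{..<T}" t] True assms
    by (auto elim!: eventually_mono simp: linear_curve_def min_def field_simps)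
  ultimately show ?thesis
    using True by (simp add: DERIV_cong_ev)
next
  case False
  have "((\<lambda>s. 1) has_real_derivative 0) (at t)"
    by simp
  moreover have "eventually (\<lambda>s. 1 = linear_curve T s) (nhds t)"
    using eventually_nhds_in_open[of "{T<..}" t] False assms
    by (auto elim!: eventually_mono simp: linear_curve_def min_def field_simps)
  ultimately show ?thesis
    using False DERIV_cong_ev[OF refl, of "\<lambda>s. 1" "linear_curve T" t 0 0] by auto
qed

text \<open>At the kink \<open>T\<close>, both \<open>linear_curve T\<close> and its difference to the line \<open>t / T\<close> are maximal, so
  that the derivative would have to be both \<open>0\<close> and \<open>1 / T\<close>.\<close>

lemma linear_curve_not_differentiable:
  assumes "T > 0"
  shows "\<not> linear_curve T differentiable (at T)"
proof
  assume "linear_curve T differentiable (at T)"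
  then obtain D where D: "(linear_curve T has_real_derivative D) (at T)"
    using real_differentiable_def by blast
  have "D = 0"
    by (rule DERIV_local_max[OF D zero_less_one]) (use assms in \<open>simp add: linear_curve_def\<close>)
  have "((\<lambda>s. linear_curve T s - s / T) has_real_derivative D - 1 / T) (at T)"
    by (intro DERIV_diff D) (use assms in \<open>auto intro!: derivative_eq_intros\<close>)
  then have "D - 1 / T = 0"
    by (rule DERIV_local_max[OF _ zero_less_one]) (use assms in \<open>simp add: linear_curve_def\<close>)
  then show False
    using \<open>D = 0\<close> assms by simp
qed

lemma charge_curve_linear:
  assumes "T > 0"
  shows "charge_curve (linear_curve T)"
proof -
  have "linear_curve T \<in> {0..} \<rightarrow> {0..1}" "linear_curve T 0 = 0"
    using assms by (auto simp: linear_curve_def)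
  moreover have "full_at (linear_curve T) T"
    using assms
    by (auto simp: full_at_def linear_curve_def min_def field_simps intro!: strict_mono_onI)
  moreover have "abs_continuous_on {0..} (linear_curve T)"
    unfolding abs_continuous_on_def
  proof (intro allI impI)
    fix \<epsilon> :: real assume "\<epsilon> > 0"
    show "\<exists>\<delta>>0. \<forall>(n::nat) a b. (\<forall>k<n. a k \<le> b k \<and> {a k..b k} \<subseteq> {0..}) \<longrightarrow>
        disjoint_family_on (\<lambda>k. {a k<..<b k}) {..<n} \<longrightarrow> (\<Sum>k<n. b k - a k) < \<delta> \<longrightarrow>
        (\<Sum>k<n. \<bar>linear_curve T (b k) - linear_curve T (a k)\<bar>) < \<epsilon>"
    proof (intro exI[of _ "\<epsilon> * T"] conjI allI impI)
      show "\<epsilon> * T > 0" using \<open>\<epsilon> > 0\<close> assms by simp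
      fix n :: nat and a b :: "nat \<Rightarrow> real"
      assume ab: "\<forall>k<n. a k \<le> b k \<and> {a k..b k} \<subseteq> {0..}" and small: "(\<Sum>k<n. b k - a k) < \<epsilon> * T"
      \<comment> \<open>\<open>linear_curve T\<close> is Lipschitz continuous with constant \<open>1 / T\<close>.\<close>
      have "\<bar>linear_curve T (b k) - linear_curve T (a k)\<bar> \<le> (b k - a k) / T" if "k < n" for k
      proof -
        have "a k / T \<le> b k / T"
          using ab that assms by (simp add: divide_right_mono)
        then show ?thesis
          by (auto simp: linear_curve_def min_def diff_divide_distrib)
      qed
      then have "(\<Sum>k<n. \<bar>linear_curve T (b k) - linear_curve T (a k)\<bar>) \<le> (\<Sum>k<n. (b k - a k) / T)"
        by (intro sum_mono) simp
      also have "\<dots> = (\<Sum>k<n. b k - a k) / T"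
        by (simp add: sum_divide_distrib)
      also have "\<dots> < \<epsilon>"
        using small assms by (simp add: field_simps)
      finally show "(\<Sum>k<n. \<bar>linear_curve T (b k) - linear_curve T (a k)\<bar>) < \<epsilon>" .
    qed
  qed
  moreover have "negligible {t. t > 0 \<and> \<not> linear_curve T differentiable (at t)}"
  proof (rule negligible_subset)
    show "{t. t > 0 \<and> \<not> linear_curve T differentiable (at t)} \<subseteq> {T}"
      using linear_curve_has_derivative[OF assms] real_differentiable_def by blast
  qed simp
  moreover have "antimono_on {t. t > 0 \<and> linear_curve T differentiable (at t)}
      (deriv (linear_curve T))"
  proof (rule monotone_onI)
    fix s t assume s: "s \<in> {t. t > 0 \<and> linear_curve T differentiable (at t)}"
      and t: "t \<in> {t. t > 0 \<and> linear_curve T differentiable (at t)}" and "s \<le> t"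
    have "deriv (linear_curve T) u = (if u < T then 1 / T else 0)" if "u \<noteq> T" for u
      using linear_curve_has_derivative[OF assms that] by (rule DERIV_imp_deriv)
    moreover have "s \<noteq> T" "t \<noteq> T"
      using s t linear_curve_not_differentiable[OF assms] by auto
    ultimately show "deriv (linear_curve T) t \<le> deriv (linear_curve T) s"
      using \<open>s \<le> t\<close> assms by auto
  qed
  ultimately show ?thesis
    unfolding charge_curve_def by blast
qed


section \<open>Relay instances\<close>

text \<open>Trip \<open>i\<close> takes place at the instant \<open>i\<close>, and the only slot is available from \<open>i\<close> to \<open>i + 1\<close>
  for each \<open>i < n\<close>. These intervals are kept as distinct elements of the availability, and not
  merged, to limit each recharge to a duration of one. Letting the consumption depend on the origin
  alone gives the triangle inequality: the first leg of a detour costs as much as the direct way.\<close>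

definition relay_instance :: "nat \<Rightarrow> (nat, nat, nat) ebsp" where
  "relay_instance n =
    \<lparr>trips = {..<n}, start_time = real, end_time = real, depots = {0}, slots = {0},
     availability = (\<lambda>_. (\<lambda>i. {real i..real i + 1}) ` {..<n}),
     connections = UNIV, travel_time = (\<lambda>_ _. 0),
     energy = (\<lambda>a _. case a of Trip_Start _ \<Rightarrow> 1 | _ \<Rightarrow> 0)\<rparr>"

lemma relay_instance_simps [simp]:
  "trips (relay_instance n) = {..<n}"
  "start_time (relay_instance n) = real"
  "end_time (relay_instance n) = real"
  "depots (relay_instance n) = {0}"
  "slots (relay_instance n) = {0}"
  "availability (relay_instance n) s = (\<lambda>i. {real i..real i + 1}) ` {..<n}"
  "connections (relay_instance n) = UNIV"
  "travel_time (relay_instance n) a b = 0"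
  "energy (relay_instance n) a b = (case a of Trip_Start _ \<Rightarrow> 1 | _ \<Rightarrow> 0)"
  "facilities (relay_instance n) = {Depot 0, Slot 0}"
  by (auto simp: relay_instance_def facilities_def)

lemma relay_required_charge [simp]:
  "required_charge (relay_instance n) a = (case a of Trip_Start _ \<Rightarrow> 1 | _ \<Rightarrow> 0)"
  by (cases a) (simp_all add: required_charge_def)

lemma ebsp_instance_relay: "ebsp_instance (relay_instance n)"
  by (auto simp: ebsp_instance_def split: location.splits)

lemma individually_serviceable_relay: "individually_serviceable (relay_instance n)"
  by (auto simp: individually_serviceable_def admissible_course_def single_trip_course_def
      activities_def)

text \<open>After its first trip the battery is empty. Before the next trip start, where a full battery
  is required, the bus recharges at most once and for a time of at most one.\<close>

lemma relay_course_at_most_one_trip: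
  assumes adm: "admissible_course (relay_instance n) C"
    and feas: "energy_feasible (relay_instance n) (linear_curve 2) C"
  shows "length (concat (blocks C)) \<le> 1"
proof (rule ccontr)
  assume two: "\<not> length (concat (blocks C)) \<le> 1"
  let ?es = "concat (map elements (activities C)) @ [(Depot (depot C), None)]"
  have sus: "sustains (relay_instance n) (linear_curve 2) 1 (Depot (depot C)) ?es"
    using feas by (simp add: energy_feasible_iff_sustains)
  have len: "length (blocks C) = length (recharges C) + 1"
    and ne: "\<And>B. B \<in> set (blocks C) \<Longrightarrow> B \<noteq> []"
    using adm by (auto simp: admissible_course_def)
  have dur: "duration r \<le> 1" if r: "r \<in> set (recharges C)" for r
  proof -
    obtain i :: nat where "{arrival r..departure r} \<subseteq> {real i..real i + 1}" "duration r \<ge> 0"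
      using adm r by (auto simp: admissible_course_def)
    then show ?thesis by auto
  qed
  obtain B Bs where blk: "blocks C = B # Bs"
    using len by (cases "blocks C") auto
  obtain \<tau> B' where B: "B = \<tau> # B'"
    using ne blk by (cases B) auto
  show False
  proof (cases B')
    case (Cons \<sigma> B'')
    then obtain as where "activities C = Service \<tau> # Service \<sigma> # as"
      unfolding activities_def blk B by (cases "recharges C") auto
    then show False
      using sus by simp
  next
    case Nil
    then obtain B2 Bs' where Bs: "Bs = B2 # Bs'"
      using two blk B by (cases Bs) auto
    obtain \<sigma> B2' where B2: "B2 = \<sigma> # B2'"
      using ne blk Bs by (cases B2) auto
    obtain r rs where rs: "recharges C = r # rs"
      using len blk Bs by (cases "recharges C") auto
    obtain as where "activities C = Service \<tau> # Charge r # Service \<sigma> # as"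
      unfolding activities_def blk B Nil Bs B2 rs by (cases rs) auto
    then have "1 \<le> linear_curve 2 (duration r)"
      using sus charge_increment_empty[OF charge_curve_linear[of 2]] by simp
    then show False
      using dur[of r] rs by (simp add: linear_curve_def)
  qed
qed

lemma card_le_relay_schedule:
  assumes S: "vehicle_schedule (relay_instance n) S"
    and feas: "\<forall>C\<in>S. energy_feasible (relay_instance n) (linear_curve 2) C"
  shows "n \<le> card S"
proof -
  have "n = (\<Sum>\<tau><n. \<Sum>C\<in>S. count_list (concat (blocks C)) \<tau>)"
    using S by (simp add: vehicle_schedule_def)
  also have "\<dots> = (\<Sum>C\<in>S. \<Sum>\<tau><n. count_list (concat (blocks C)) \<tau>)"
    by (rule sum.swap)
  also have "\<dots> \<le> (\<Sum>C\<in>S. 1)"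
  proof (rule sum_mono)
    fix C assume C: "C \<in> S"
    then have adm: "admissible_course (relay_instance n) C"
      using S by (simp add: vehicle_schedule_def)
    then have "set (concat (blocks C)) \<subseteq> {..<n}"
      by (auto simp: admissible_course_def)
    then have "(\<Sum>\<tau><n. count_list (concat (blocks C)) \<tau>) = length (concat (blocks C))"
      by (intro sum_count_set) auto
    then show "(\<Sum>\<tau><n. count_list (concat (blocks C)) \<tau>) \<le> 1"
      using relay_course_at_most_one_trip[OF adm] feas C by simp
  qed
  finally show ?thesis by simp
qed

definition relay_recharge :: "nat \<Rightarrow> nat recharge" where
  "relay_recharge i = \<lparr>slot = 0, arrival = real i, duration = 1\<rparr>"

definition relay_course :: "nat \<Rightarrow> (nat, nat, nat) course" where
  "relay_course m =
    \<lparr>depot = 0, blocks = map (\<lambda>i. [i]) [0..<Suc m], recharges = map relay_recharge [0..<m]\<rparr>"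

fun relay_activities :: "nat \<Rightarrow> nat \<Rightarrow> (nat, nat) activity list" where
  "relay_activities k 0 = [Service k]"
| "relay_activities k (Suc m) =
    Service k # Charge (relay_recharge k) # relay_activities (Suc k) m"

lemma alternate_relay:
  "alternate (map (\<lambda>i. [i]) [k..<Suc (k + m)]) (map relay_recharge [k..<k + m])
    = relay_activities k m"
proof (induction m arbitrary: k)
  case (Suc m)
  have "[k..<Suc (k + Suc m)] = k # [Suc k..<Suc (Suc k + m)]"
    "[k..<k + Suc m] = k # [Suc k..<Suc k + m]"
    by (simp_all add: upt_conv_Cons del: upt_Suc)
  then show ?case
    using Suc.IH[of "Suc k"] by (simp del: upt_Suc)
qed simp

lemma activities_relay_course: "activities (relay_course m) = relay_activities 0 m"
  using alternate_relay[of 0 m] by (simp add: activities_def relay_course_def)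

lemma successively_relay_activities:
  "successively (can_follow (relay_instance n)) (relay_activities k m)"
proof (induction m arbitrary: k)
  case (Suc m)
  then show ?case
    by (cases m) (use Suc.IH[of "Suc k"] in \<open>simp_all add: can_follow_def relay_recharge_def\<close>)
qed simp

lemma admissible_relay_course:
  "admissible_course (relay_instance (Suc m)) (relay_course m)"
proof -
  have "\<exists>J\<in>availability (relay_instance (Suc m)) 0.
      {arrival (relay_recharge i)..departure (relay_recharge i)} \<subseteq> J" if "i < m" for i
    using that by (auto simp: relay_recharge_def intro!: bexI[of _ i])
  then show ?thesis
    using successively_relay_activities[of "Suc m" 0 m]
    by (auto simp: admissible_course_def activities_relay_course)
      (auto simp: relay_course_def relay_recharge_def)
qed

text \<open>Each trip is reached with a full battery: it leaves the battery empty, and charging for a time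
  of one refills it.\<close>

lemma sustains_relay_activities:
  assumes "\<And>b. energy (relay_instance n) a b = 0"
  shows "sustains (relay_instance n) (linear_curve 1) 1 a
    (concat (map elements (relay_activities k m)) @ [(Depot 0, None)])"
  using assms
proof (induction m arbitrary: k a)
  case 0
  then show ?case by simp
next
  case (Suc m)
  have "linear_curve 1 1 = 1" by (simp add: linear_curve_def)
  then show ?case
    using Suc.prems Suc.IH[of "Slot 0" "Suc k"] charge_increment_empty[OF charge_curve_linear[of 1]]
    by (simp add: relay_recharge_def)
qed

lemma energy_feasible_relay_course:
  "energy_feasible (relay_instance n) (linear_curve 1) (relay_course m)"
proof -
  have "depot (relay_course m) = 0"
    by (simp add: relay_course_def)
  then show ?thesis
    using sustains_relay_activities[of n "Depot 0" 0 m]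
    by (simp add: energy_feasible_iff_sustains activities_relay_course)
qed

lemma count_list_upt: "count_list [0..<n] i = (if i < n then 1 else 0)"
  by (induction n) auto

lemma min_courses_relay:
  "min_courses (relay_instance (Suc m)) (energy_feasible (relay_instance (Suc m)) (linear_curve 1))
    = 1"
proof (rule antisym)
  have "concat (blocks (relay_course m)) = [0..<Suc m]"
    by (simp add: relay_course_def concat_map_singleton del: upt_Suc)
  then have "vehicle_schedule (relay_instance (Suc m)) {relay_course m}"
    using admissible_relay_course
    by (simp add: vehicle_schedule_def count_list_upt del: upt_Suc)
  then show "min_courses (relay_instance (Suc m))
      (energy_feasible (relay_instance (Suc m)) (linear_curve 1)) \<le> 1"
    unfolding min_courses_def
    by (intro INF_lower2[of "{relay_course m}"])
      (simp_all add: energy_feasible_relay_course one_enat_def)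
qed (auto intro!: min_courses_ge_1)

lemma strong_min_courses_relay:
  "min_courses (relay_instance (Suc m))
      (strongly_energy_feasible (relay_instance (Suc m)) (linear_curve 1) (linear_curve 2))
    = enat (Suc m)"
proof (rule antisym)
  let ?I = "relay_instance (Suc m)"
  show "min_courses ?I (strongly_energy_feasible ?I (linear_curve 1) (linear_curve 2))
      \<le> enat (Suc m)"
    using min_courses_le_card_trips[OF ebsp_instance_relay individually_serviceable_relay,
        of "Suc m" "linear_curve 1" "linear_curve 2"] by simp
  show "enat (Suc m)
      \<le> min_courses ?I (strongly_energy_feasible ?I (linear_curve 1) (linear_curve 2))"
    unfolding min_courses_def strongly_energy_feasible_def
    by (rule INF_greatest) (use card_le_relay_schedule[of "Suc m"] in auto)
qed

theorem theorem4p7: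
  shows
    "(\<forall>\<zeta> \<zeta>' (I :: ('t, 'd, 's) ebsp).
        charge_curve \<zeta> \<longrightarrow> charge_curve \<zeta>' \<longrightarrow>
        ebsp_instance I \<longrightarrow> trips I \<noteq> {} \<longrightarrow> individually_serviceable I \<longrightarrow>
        min_courses I (strongly_energy_feasible I \<zeta> \<zeta>')
          \<le> enat (card (trips I)) * min_courses I (energy_feasible I \<zeta>)) \<and>
     (\<exists>\<zeta> \<zeta>'. charge_curve \<zeta> \<and> charge_curve \<zeta>' \<and>
        (\<forall>N. \<exists>I :: (nat, nat, nat) ebsp.
          ebsp_instance I \<and> individually_serviceable I \<and> card (trips I) > N \<and>
          min_courses I (strongly_energy_feasible I \<zeta> \<zeta>')
            = enat (card (trips I)) * min_courses I (energy_feasible I \<zeta>)))"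
proof (intro conjI allI impI)
  show "\<exists>\<zeta> \<zeta>'. charge_curve \<zeta> \<and> charge_curve \<zeta>' \<and>
      (\<forall>N. \<exists>I :: (nat, nat, nat) ebsp.
        ebsp_instance I \<and> individually_serviceable I \<and> card (trips I) > N \<and>
        min_courses I (strongly_energy_feasible I \<zeta> \<zeta>')
          = enat (card (trips I)) * min_courses I (energy_feasible I \<zeta>))"
  proof (intro exI conjI allI)
    fix N :: nat
    show "ebsp_instance (relay_instance (Suc N))" by (rule ebsp_instance_relay)
    show "individually_serviceable (relay_instance (Suc N))"
      by (rule individually_serviceable_relay)
    show "card (trips (relay_instance (Suc N))) > N" by simp
    show "min_courses (relay_instance (Suc N))
        (strongly_energy_feasible (relay_instance (Suc N)) (linear_curve 1) (linear_curve 2))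
      = enat (card (trips (relay_instance (Suc N)))) *
        min_courses (relay_instance (Suc N))
          (energy_feasible (relay_instance (Suc N)) (linear_curve 1))"
      by (simp add: min_courses_relay strong_min_courses_relay)
  qed (simp_all add: charge_curve_linear)
qed (rule strong_min_courses_le)

end
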